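(* Let $q$ be a prime power, let $1\leq t<k$ and $n\geq (4k+4)^2\genfrac{[}{]}{0pt}{}{k}{t}_q^2$ be positive integers, and let $V$ be an $n$-dimensional vector space over $\mathbb{F}_q$. Let $\mathcal{F}$ be a family of $k$-dimensional subspaces of $V$ with size $|\mathcal{F}|=\delta\genfrac{[}{]}{0pt}{}{n-t}{k-t}_q$ for some $\delta\in\left[\frac{(4k+4)^2n}{q^{n-k}},\,1+\frac{1}{96\,t\,(\ln q)\,(k+1)}\right]$ satisfying $\mathcal{I}(\mathcal{F})=\mathcal{MI}(\mathcal{F})$. Then, when $\delta\leq 1$, $\mathcal{F}$ is contained in a full $t$-star, and when $\delta>1$, $\mathcal{F}$ contains a full $t$-star.
   Context: $\mathbb{F}_q$ is the finite field with $q$ elements. The Gaussian binomial coefficient is $\genfrac{[}{]}{0pt}{}{n}{k}_q=\prod_{i=0}^{k-1}\frac{q^{n-i}-1}{q^{k-i}-1}$. $\genfrac{[}{]}{0pt}{}{V}{k}$ denotes the collection of all $k$-dimensional subspaces of $V$. For $\mathcal{F}\subseteq \genfrac{[}{]}{0pt}{}{V}{k}$, the total intersection number is $\mathcal{I}(\mathcal{F})=\sum_{A\in\mathcal{F}}\sum_{B\in\mathcal{F}}\dim(A\cap B)$ (sum over ordered pairs, including $A=B$), and $\mathcal{MI}(\mathcal{F})=\max\{\mathcal{I}(\mathcal{G}):\mathcal{G}\subseteq \genfrac{[}{]}{0pt}{}{V}{k},\ |\mathcal{G}|=|\mathcal{F}|\}$. A full $t$-star is the family of all $k$-dimensional subspaces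 of $V$ containing some fixed $t$-dimensional subspace of $V$. *)

theory Defs
  imports Complex_Main "HOL-Library.Cardinality"
begin

text \<open>
  For i < k the exponent k - i is positive, so no denominator vanishes when q > 1.  The truncated
  subtraction n - i is harmless: if n < k, the factor for i = n already makes the product 0.
\<close>

definition gauss_binomial :: "real \<Rightarrow> nat \<Rightarrow> nat \<Rightarrow> real" where
  "gauss_binomial q n k = (\<Prod>i<k. (q ^ (n - i) - 1) / (q ^ (k - i) - 1))"

text \<open>
  Below, V is the whole type 'v with scalar multiplication scale.  The definitions are meant for a
  finite-dimensional V over a finite field; there every family of subspaces is a finite set, so
  the sums and the maximum below are taken over finite sets, and for a family F of k-dimensional
  subspaces the maximum in max_total_inter is over a set that contains the value at F itself.
\<close>

definition subspaces_of_dim ::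
  "('f::field \<Rightarrow> 'v::ab_group_add \<Rightarrow> 'v) \<Rightarrow> nat \<Rightarrow> 'v set set" where
  "subspaces_of_dim scale k = {A. module.subspace scale A \<and> vector_space.dim scale A = k}"

definition total_inter ::
  "('f::field \<Rightarrow> 'v::ab_group_add \<Rightarrow> 'v) \<Rightarrow> 'v set set \<Rightarrow> nat" where
  "total_inter scale F = (\<Sum>A\<in>F. \<Sum>B\<in>F. vector_space.dim scale (A \<inter> B))"

definition max_total_inter ::
  "('f::field \<Rightarrow> 'v::ab_group_add \<Rightarrow> 'v) \<Rightarrow> nat \<Rightarrow> 'v set set \<Rightarrow> nat" where
  "max_total_inter scale k F =
     Max {total_inter scale G | G. G \<subseteq> subspaces_of_dim scale k \<and> card G = card F}"

definition full_star ::
  "('f::field \<Rightarrow> 'v::ab_group_add \<Rightarrow> 'v) \<Rightarrow> nat \<Rightarrow> nat \<Rightarrow> 'v set set \<Rightarrow> bool" where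
  "full_star scale k t S \<longleftrightarrow>
     (\<exists>T\<in>subspaces_of_dim scale t. S = {A \<in> subspaces_of_dim scale k. T \<subseteq> A})"

end

theory Submission
  imports Defs
begin

text \<open>
  Write \<open>m\<close> for the size of \<open>F\<close>.  A family that is comparable with a full \<open>t\<close>-star shows that the
  maximum is at least \<open>t m\<^sup>2 - m\<^sup>2 / (24 (k + 1))\<close>.  A fixed \<open>A\<close> meets only very few members of
  \<open>F\<close> in dimension greater than \<open>t\<close>, so nearly all pairs of members meet in dimension exactly \<open>t\<close>.
  Choose \<open>A\<close> and then \<open>C\<close> in \<open>F\<close>, both meeting almost all of \<open>F\<close> in dimension at least \<open>t\<close>, with
  \<open>T = A \<inter> C\<close> of dimension \<open>t\<close>.  A member \<open>B\<close> with \<open>A \<inter> B \<noteq> T\<close> contains another \<open>t\<close>-subspace of \<open>A\<close>,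
  which \<open>C\<close> does not contain; few such \<open>B\<close> meet \<open>C\<close> in dimension at least \<open>t\<close>.  Hence all but a
  fraction \<open>1 / (10 (k + 1))\<close> of \<open>F\<close> contains \<open>T\<close>.  Replacing a member of \<open>F\<close> that does not contain
  \<open>T\<close> by a \<open>k\<close>-space outside \<open>F\<close> that does would then increase the total intersection number, so \<open>F\<close>
  and the full star of \<open>T\<close> are comparable, and their sizes decide which one is the larger.
\<close>

subsection \<open>Gaussian binomial coefficients\<close>

lemma gauss_binomial_0 [simp]: "gauss_binomial q n 0 = 1"
  by (simp add: gauss_binomial_def)

lemma gauss_binomial_Suc_Suc:
  "gauss_binomial q (Suc n) (Suc k) = (q ^ Suc n - 1) / (q ^ Suc k - 1) * gauss_binomial q n k"
  by (simp add: gauss_binomial_def prod.lessThan_Suc_shift del: prod.lessThan_Suc)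

lemma gauss_binomial_1: "gauss_binomial q n 1 = (q ^ n - 1) / (q - 1)"
  by (simp add: gauss_binomial_def)

lemma gauss_binomial_Suc:
  assumes "q > 1"
  shows "gauss_binomial q n (Suc k) = gauss_binomial q n k * (q ^ (n - k) - 1) / (q ^ Suc k - 1)"
proof (induction k arbitrary: n)
  case 0
  then show ?case by (simp add: gauss_binomial_def)
next
  case (Suc k)
  show ?case
  proof (cases n)
    case 0
    then show ?thesis by (simp add: gauss_binomial_def)
  next
    case (Suc l)
    then show ?thesis
      using Suc.IH[of l] by (simp only: gauss_binomial_Suc_Suc) (simp add: mult_ac)
  qed
qed

lemma gauss_binomial_ge_1:
  assumes "q > 1" "k \<le> n"
  shows "gauss_binomial q n k \<ge> 1"
  unfolding gauss_binomial_def
proof (rule prod_ge_1)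
  fix i assume "i \<in> {..<k}"
  then have "q ^ (k - i) > 1" "q ^ (n - i) \<ge> q ^ (k - i)"
    using assms by (auto intro: power_increasing)
  then show "1 \<le> (q ^ (n - i) - 1) / (q ^ (k - i) - 1)" by simp
qed

text \<open>Peeling the factor \<open>(q ^ n - 1) / (q ^ Suc k - 1)\<close> off both sides leaves a
  comparison of points in dimensions k + 1 and n - 1, followed by the induction hypothesis. The case
  k = n is excluded because the right side would be 1.\<close>

lemma gauss_binomial_1_le:
  assumes "q > 1" "1 \<le> k" "k < n"
  shows "gauss_binomial q n 1 \<le> gauss_binomial q n k"
  using assms(2,3)
proof (induction k arbitrary: n rule: nat_induct_at_least)
  case base
  then show ?case by simp
next
  case (Suc k)
  obtain l where l: "n = Suc l" "k < l" using Suc.prems by (cases n) auto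
  have gt: "q ^ Suc k > 1" using assms(1) by (rule one_less_power) simp
  have le: "q ^ Suc k \<le> q ^ l" using assms(1) l by (intro power_increasing) auto
  have pos: "q ^ n > 1" using assms(1) l by (intro one_less_power) auto
  have "gauss_binomial q n 1 = (q ^ n - 1) / (q ^ Suc k - 1) * ((q ^ Suc k - 1) / (q - 1))"
    using gt by (simp only: gauss_binomial_1) simp
  also have "\<dots> \<le> (q ^ n - 1) / (q ^ Suc k - 1) * ((q ^ l - 1) / (q - 1))"
    using gt le pos assms(1) by (intro mult_left_mono divide_right_mono) auto
  also have "\<dots> \<le> (q ^ n - 1) / (q ^ Suc k - 1) * gauss_binomial q l k"
    using Suc.IH[OF l(2)] gt pos unfolding gauss_binomial_1
    by (intro mult_left_mono) auto
  also have "\<dots> = gauss_binomial q n (Suc k)"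
    unfolding l(1) gauss_binomial_Suc_Suc by simp
  finally show ?case .
qed

text \<open>The ratio of the two consecutive coefficients is at most
  \<open>gauss_binomial q n 1\<close>, hence at most the smaller index coefficient itself. This will
  bound the number of (t + 1)-subspaces of a k-space by the square of the number of its
  t-subspaces.\<close>

lemma gauss_binomial_Suc_le_square:
  assumes "q > 1" "1 \<le> k" "k < n"
  shows "gauss_binomial q n (Suc k) \<le> (gauss_binomial q n k)\<^sup>2"
proof -
  let ?N = "gauss_binomial q n k"
  have N: "?N \<ge> 1" using gauss_binomial_ge_1 assms by simp
  have gt: "q ^ Suc k \<ge> q" using power_increasing[of 1 "Suc k" q] assms(1) by simp
  have le: "q ^ (n - k) \<le> q ^ n" using assms(1) by (intro power_increasing) auto
  have ge: "q ^ n \<ge> 1" using assms(1) by (simp add: one_le_power)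
  have "(q ^ (n - k) - 1) / (q ^ Suc k - 1) \<le> (q ^ n - 1) / (q - 1)"
    using gt le ge assms(1) by (intro frac_le) auto
  also have "\<dots> \<le> ?N" using gauss_binomial_1_le[OF assms] by (simp only: gauss_binomial_1)
  finally have "(q ^ (n - k) - 1) / (q ^ Suc k - 1) \<le> ?N" .
  then have "?N * ((q ^ (n - k) - 1) / (q ^ Suc k - 1)) \<le> ?N * ?N"
    using N by (intro mult_left_mono) auto
  then show ?thesis
    by (simp only: gauss_binomial_Suc[OF assms(1)] power2_eq_square times_divide_eq_right)
qed

text \<open>Used to compare the k-spaces through a t-space with those through a (t + 1)-space: the
  former are at least \<open>q ^ (n - k)\<close> times as many.\<close>

lemma gauss_binomial_Suc_Suc_ge:
  assumes "q > 1" "k \<le> n"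
  shows "q ^ (n - k) * gauss_binomial q n k \<le> gauss_binomial q (Suc n) (Suc k)"
proof -
  have gt: "q ^ Suc k > 1" using assms(1) by (rule one_less_power) simp
  have "q ^ (n - k) * q ^ Suc k = q ^ Suc n"
    using assms(2) by (simp flip: power_add)
  moreover have "q ^ (n - k) \<ge> 1" using assms(1) by (simp add: one_le_power)
  ultimately have "q ^ (n - k) * (q ^ Suc k - 1) \<le> q ^ Suc n - 1"
    by (simp add: right_diff_distrib del: power_Suc)
  then have "q ^ (n - k) \<le> (q ^ Suc n - 1) / (q ^ Suc k - 1)"
    using gt by (simp add: pos_le_divide_eq del: power_Suc)
  then show ?thesis
    using gauss_binomial_ge_1[OF assms] unfolding gauss_binomial_Suc_Suc
    by (intro mult_right_mono) auto
qed

section \<open>Averaging, choice of subsets, and an elementary inequality\<close>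

lemma sum_le_imp_exists_card_times_le:
  fixes f :: "'a \<Rightarrow> real"
  assumes "finite A" "A \<noteq> {}" "sum f A \<le> b"
  obtains x where "x \<in> A" "real (card A) * f x \<le> b"
proof -
  have "Min (f ` A) \<in> f ` A" using assms by simp
  then obtain x where x: "x \<in> A" "f x = Min (f ` A)" by auto
  have "real (card A) * f x \<le> sum f A"
    using assms(1) x(2) by (intro sum_bounded_below) simp
  then show thesis using x(1) assms(3) that by force
qed

text \<open>Provides the competitor: a family of the size of \<open>F\<close> that lies inside a
  star or contains it, whichever the size allows.\<close>

lemma exists_comparable_subset_of_card:
  assumes "finite U" "S \<subseteq> U" "c \<le> card U"
  obtains G where "G \<subseteq> U" "card G = c" "G \<subseteq> S \<or> S \<subseteq> G"
proof (cases "c \<le> card S")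
  case True
  then obtain G where "G \<subseteq> S" "card G = c" using obtain_subset_with_card_n by metis
  then show thesis using that assms(2) by blast
next
  case False
  then obtain G where "S \<subseteq> G" "G \<subseteq> U" "card G = c"
    using exists_subset_between[of S c U] assms by auto
  then show thesis using that by blast
qed

text \<open>The left side is the tangent line at 1 of the convex function on the right.\<close>

lemma inverse_square_ge:
  fixes \<delta> :: real
  assumes "\<delta> \<ge> 1"
  shows "1 - 2 * (\<delta> - 1) \<le> 1 / \<delta>\<^sup>2"
proof -
  have "0 \<le> (\<delta> - 1)\<^sup>2 * (2 * \<delta> + 1)" using assms by simp
  also have "\<dots> = 1 - (1 - 2 * (\<delta> - 1)) * \<delta>\<^sup>2" by (simp add: power2_eq_square algebra_simps)
  finally show ?thesis using assms by (simp add: pos_le_divide_eq)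
qed

subsection \<open>Counting subspaces over a finite field\<close>

locale finite_field_space = finite_dimensional_vector_space scale Basis
  for scale :: "'f :: {finite, field} \<Rightarrow> 'v :: ab_group_add \<Rightarrow> 'v" and Basis
begin

text \<open>Every vector of the larger span is \<open>scale c a + s\<close> for exactly one scalar
  \<open>c\<close> and one \<open>s\<close> in \<open>span S\<close>.\<close>

lemma card_span_insert:
  assumes "a \<notin> span S"
  shows "card (span (insert a S)) = CARD('f) * card (span S)"
proof -
  let ?h = "\<lambda>(c, s). scale c a + s"
  have inj: "inj_on ?h (UNIV \<times> span S)"
  proof (rule inj_onI, clarify)
    fix c d x y assume *: "x \<in> span S" "y \<in> span S" "scale c a + x = scale d a + y"
    have "scale (c - d) a = y - x" using *(3) by (simp add: scale_left_diff_distrib algebra_simps)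
    then have "scale (c - d) a \<in> span S" using * by (metis span_diff)
    have "c = d"
    proof (rule ccontr)
      assume "c \<noteq> d"
      then have "a = scale (inverse (c - d)) (scale (c - d) a)" by simp
      then show False using \<open>scale (c - d) a \<in> span S\<close> assms by (metis span_scale)
    qed
    then show "c = d \<and> x = y" using *(3) by simp
  qed
  have "?h ` (UNIV \<times> span S) = span (insert a S)"
  proof (intro equalityI subsetI)
    fix x assume "x \<in> span (insert a S)"
    then obtain c where "x - scale c a \<in> span S" by (auto simp: span_insert)
    moreover have "x = ?h (c, x - scale c a)" by simp
    ultimately show "x \<in> ?h ` (UNIV \<times> span S)" by blast
  next
    fix x assume "x \<in> ?h ` (UNIV \<times> span S)"
    then obtain c s where "x = scale c a + s" "s \<in> span S" by auto
    then show "x \<in> span (insert a S)" by (auto simp: span_insert intro!: exI[of _ c])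
  qed
  then show ?thesis using card_image[OF inj] by (simp add: card_cartesian_product)
qed

lemma card_subspace:
  assumes "subspace A"
  shows "card A = CARD('f) ^ dim A"
proof -
  have span: "card (span B) = CARD('f) ^ card B" if "finite B" "independent B" for B
    using that
  proof (induction B rule: finite_induct)
    case empty
    then show ?case by simp
  next
    case (insert a B)
    then show ?case by (simp add: independent_insert card_span_insert)
  qed
  obtain B where B: "independent B" "span B = A" "card B = dim A"
    using basis_subspace_exists[OF assms] by metis
  then show ?thesis using span finiteI_independent by metis
qed

lemma finite_UNIV_vec: "finite (UNIV :: 'v set)"
proof -
  \<comment> \<open>\<open>card\<close> is 0 on infinite sets, so a positive value forces
    finiteness.\<close>
  have "card (UNIV :: 'v set) > 0"
    by (simp add: card_subspace subspace_UNIV)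
  then show ?thesis by (rule card_ge_0_finite)
qed

lemma finite_vec_set [simp, intro]: "finite (A :: 'v set)"
  using finite_UNIV_vec by (rule rev_finite_subset) simp

lemma finite_subspace_family [simp, intro]: "finite (\<F> :: 'v set set)"
  using finite_UNIV_vec by (simp add: Finite_Set.finite_set finite_subset[of _ UNIV])

lemma CARD_field_gt_1: "CARD('f) > 1"
proof -
  have "card {0, 1 :: 'f} \<le> CARD('f)" by (intro card_mono) auto
  then show ?thesis by simp
qed

lemma dim_span_insert:
  assumes "subspace T" "v \<notin> T"
  shows "dim (span (insert v T)) = Suc (dim T)"
  using assms by (simp add: dim_insert span_eq_iff[THEN iffD2])

text \<open>Counting the pairs \<open>(v, U)\<close> with \<open>v \<in> U - T\<close> in two ways gives the recursion.\<close>

lemma card_subspaces_between: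
  assumes "subspace T" "subspace W" "T \<subseteq> W" "dim T \<le> k" "k \<le> dim W"
  shows "real (card {U. subspace U \<and> dim U = k \<and> T \<subseteq> U \<and> U \<subseteq> W})
    = gauss_binomial (real CARD('f)) (dim W - dim T) (k - dim T)"
  using assms(1,3,4)
proof (induction "k - dim T" arbitrary: T)
  case 0
  then have "k = dim T" by simp
  then have "{U. subspace U \<and> dim U = k \<and> T \<subseteq> U \<and> U \<subseteq> W} = {T}"
    using 0 subspace_dim_equal[of T, symmetric] by (intro equalityI subsetI) auto
  then show ?case using \<open>k = dim T\<close> by simp
next
  case (Suc d)
  let ?q = "real CARD('f)" and ?t = "dim T" and ?w = "dim W"
  let ?\<U> = "\<lambda>T. {U. subspace U \<and> dim U = k \<and> T \<subseteq> U \<and> U \<subseteq> W}"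
  have lt: "?t < k" "?t < ?w" using Suc.hyps(2) assms(5) by auto
  let ?g = "gauss_binomial ?q (?w - Suc ?t) (k - Suc ?t)"
  have q: "?q > 1" using CARD_field_gt_1 by linarith
  have diff: "real (card (U - T)) = ?q ^ dim U - ?q ^ ?t" if "subspace U" "T \<subseteq> U" for U
    using that Suc.prems card_subspace[of U] card_subspace[of T] card_mono[of U T]
    by (simp add: card_Diff_subset of_nat_diff)
  \<comment> \<open>Each \<open>U\<close> has exactly \<open>?q ^ k - ?q ^ ?t\<close> vectors
    outside \<open>T\<close>.\<close>
  have "real (card (?\<U> T)) * (?q ^ k - ?q ^ ?t) = (\<Sum>U\<in>?\<U> T. real (card (U - T)))"
    by (simp add: diff)
  also have "\<dots> = (\<Sum>U\<in>?\<U> T. \<Sum>v\<in>W - T. of_bool (v \<in> U))"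
  proof (rule sum.cong[OF refl])
    fix U assume "U \<in> ?\<U> T"
    then have "U - T = (W - T) \<inter> {v. v \<in> U}" by auto
    then show "real (card (U - T)) = (\<Sum>v\<in>W - T. of_bool (v \<in> U))"
      by simp
  qed
  also have "\<dots> = (\<Sum>v\<in>W - T. \<Sum>U\<in>?\<U> T. of_bool (v \<in> U))" by (rule sum.swap)
  also have "\<dots> = (\<Sum>v\<in>W - T. ?g)"
  proof (rule sum.cong[OF refl])
    fix v assume v: "v \<in> W - T"
    \<comment> \<open>The \<open>U\<close> containing \<open>T\<close> and \<open>v\<close> are
      those containing this span, one dimension up, so the induction hypothesis gives a count that
      does not depend on \<open>v\<close>.\<close>
    let ?T = "span (insert v T)"
    have dT: "dim ?T = Suc ?t" using dim_span_insert Suc.prems v by blast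
    have sub: "?T \<subseteq> U \<longleftrightarrow> T \<subseteq> U \<and> v \<in> U" if "subspace U" for U
      using that span_minimal[of "insert v T" U] span_superset[of "insert v T"] by blast
    have "real (card (?\<U> ?T)) = gauss_binomial ?q (?w - dim ?T) (k - dim ?T)"
      using Suc.hyps(2) Suc.prems v lt sub[OF assms(2)] dT by (intro Suc.hyps(1)) auto
    moreover have "?\<U> ?T = ?\<U> T \<inter> {U. v \<in> U}" using sub by auto
    ultimately show "(\<Sum>U\<in>?\<U> T. of_bool (v \<in> U)) = ?g" using dT by simp
  qed
  also have "\<dots> = (?q ^ ?w - ?q ^ ?t) * ?g" using diff[OF assms(2)] Suc.prems by simp
  finally have main: "real (card (?\<U> T)) * (?q ^ k - ?q ^ ?t) = (?q ^ ?w - ?q ^ ?t) * ?g" .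
  have factor: "?q ^ a - ?q ^ ?t = ?q ^ ?t * (?q ^ (a - ?t) - 1)" if "?t < a" for a
    using that by (simp add: right_diff_distrib flip: power_add)
  have "?q ^ (k - ?t) > 1" using q lt by (simp add: one_less_power del: of_nat_power)
  moreover have "?q ^ ?t * (real (card (?\<U> T)) * (?q ^ (k - ?t) - 1))
      = ?q ^ ?t * ((?q ^ (?w - ?t) - 1) * ?g)"
    using main unfolding factor[OF lt(1)] factor[OF lt(2)] by (simp only: mult_ac)
  then have "real (card (?\<U> T)) * (?q ^ (k - ?t) - 1) = (?q ^ (?w - ?t) - 1) * ?g"
    using q by (simp only: mult_cancel_left) simp
  ultimately have "real (card (?\<U> T)) = (?q ^ (?w - ?t) - 1) / (?q ^ (k - ?t) - 1) * ?g"
    by (simp add: nonzero_eq_divide_eq del: of_nat_power)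
  then show ?case
    using gauss_binomial_Suc_Suc[of ?q "?w - Suc ?t" "k - Suc ?t"] lt
    by (simp add: Suc_diff_Suc del: power_Suc)
qed

definition gaussian :: "nat \<Rightarrow> nat \<Rightarrow> real" where
  "gaussian = gauss_binomial (real CARD('f))"

lemma mem_subspaces_of_dim:
  "A \<in> subspaces_of_dim scale k \<longleftrightarrow> subspace A \<and> dim A = k"
  by (simp add: subspaces_of_dim_def)

lemma card_superspaces:
  assumes "U \<in> subspaces_of_dim scale u" "u \<le> k" "k \<le> dim UNIV"
  shows "real (card {B \<in> subspaces_of_dim scale k. U \<subseteq> B}) = gaussian (dim UNIV - u) (k - u)"
  using assms card_subspaces_between[of U UNIV k]
  by (simp add: subspaces_of_dim_def gaussian_def conj_ac)

lemma card_subspaces_of: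
  assumes "subspace A" "u \<le> dim A"
  shows "real (card {U \<in> subspaces_of_dim scale u. U \<subseteq> A}) = gaussian (dim A) u"
proof -
  have "{U \<in> subspaces_of_dim scale u. U \<subseteq> A}
      = {U. subspace U \<and> dim U = u \<and> {0} \<subseteq> U \<and> U \<subseteq> A}"
    by (auto simp: subspaces_of_dim_def subspace_0)
  then show ?thesis
    using assms card_subspaces_between[of "{0}" A u]
    by (simp add: gaussian_def subspace_0)
qed

text \<open>Such a \<open>B\<close> contains some (t + 1)-subspace of \<open>A\<close>; the union
  bound over these subspaces gives the product.\<close>

lemma card_dim_Int_gt_le:
  assumes A: "A \<in> subspaces_of_dim scale k" and "t < k" "k \<le> dim UNIV"
  shows "real (card {B \<in> subspaces_of_dim scale k. t < dim (A \<inter> B)})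
    \<le> gaussian k (Suc t) * gaussian (dim UNIV - Suc t) (k - Suc t)"
proof -
  let ?\<U> = "{U \<in> subspaces_of_dim scale (Suc t). U \<subseteq> A}"
  let ?\<B> = "\<lambda>U. {B \<in> subspaces_of_dim scale k. U \<subseteq> B}"
  have "\<exists>U\<in>?\<U>. B \<in> ?\<B> U" if B: "B \<in> subspaces_of_dim scale k" "t < dim (A \<inter> B)" for B
  proof -
    obtain U where "subspace U" "U \<subseteq> span (A \<inter> B)" "dim U = Suc t"
      using choose_subspace_of_subspace[of "Suc t" "A \<inter> B"] B(2) by auto
    moreover have "span (A \<inter> B) = A \<inter> B"
      using A B(1) by (simp add: mem_subspaces_of_dim subspace_inter span_eq_iff[THEN iffD2])
    ultimately show ?thesis using B(1) by (auto simp: mem_subspaces_of_dim)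
  qed
  then have "{B \<in> subspaces_of_dim scale k. t < dim (A \<inter> B)} \<subseteq> (\<Union>U\<in>?\<U>. ?\<B> U)" by blast
  then have "card {B \<in> subspaces_of_dim scale k. t < dim (A \<inter> B)} \<le> card (\<Union>U\<in>?\<U>. ?\<B> U)"
    by (intro card_mono) auto
  also have "\<dots> \<le> (\<Sum>U\<in>?\<U>. card (?\<B> U))" by (rule card_UN_le) auto
  finally have "real (card {B \<in> subspaces_of_dim scale k. t < dim (A \<inter> B)})
      \<le> (\<Sum>U\<in>?\<U>. real (card (?\<B> U)))" by (simp flip: of_nat_sum)
  also have "\<dots> = (\<Sum>U\<in>?\<U>. gaussian (dim UNIV - Suc t) (k - Suc t))"
    using assms by (intro sum.cong card_superspaces) auto
  also have "\<dots> = gaussian k (Suc t) * gaussian (dim UNIV - Suc t) (k - Suc t)"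
    using A card_subspaces_of[of A "Suc t"] assms(2) by (simp add: mem_subspaces_of_dim)
  finally show ?thesis .
qed

lemma dim_Un_le: "dim (S \<union> T) \<le> dim S + dim T"
proof -
  obtain B where B: "independent B" "S \<subseteq> span B" "card B = dim S"
    using basis_exists by metis
  obtain C where C: "independent C" "T \<subseteq> span C" "card C = dim T"
    using basis_exists by metis
  have "S \<union> T \<subseteq> span (B \<union> C)"
    using B(2) C(2) span_mono[of B "B \<union> C"] span_mono[of C "B \<union> C"] by blast
  then have "dim (S \<union> T) \<le> card (B \<union> C)"
    by (rule dim_le_card) simp
  then show ?thesis using card_Un_le[of B C] B(3) C(3) by linarith
qed

text \<open>Such a \<open>B\<close> contains a \<open>(t + 1)\<close>-dimensional space lying between \<open>T\<close> and \<open>T + C\<close>.\<close>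

lemma card_superspaces_dim_Int_ge_le:
  assumes T: "T \<in> subspaces_of_dim scale t" and C: "C \<in> subspaces_of_dim scale k"
    and "\<not> T \<subseteq> C" "t < k" "k \<le> dim UNIV"
  shows "real (card {B \<in> subspaces_of_dim scale k. T \<subseteq> B \<and> t \<le> dim (C \<inter> B)})
    \<le> gaussian k 1 * gaussian (dim UNIV - Suc t) (k - Suc t)"
proof -
  let ?W = "span (T \<union> C)" and ?q = "real CARD('f)"
  let ?\<U> = "{U. subspace U \<and> dim U = Suc t \<and> T \<subseteq> U \<and> U \<subseteq> ?W}"
  let ?\<B> = "\<lambda>U. {B \<in> subspaces_of_dim scale k. U \<subseteq> B}"
  let ?S = "{B \<in> subspaces_of_dim scale k. T \<subseteq> B \<and> t \<le> dim (C \<inter> B)}"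
  have T': "subspace T" "dim T = t" and C': "subspace C" "dim C = k"
    using T C by (simp_all add: mem_subspaces_of_dim)
  have TW: "T \<subseteq> ?W" and CW: "C \<subseteq> ?W" using span_superset[of "T \<union> C"] by auto
  have "\<exists>U\<in>?\<U>. B \<in> ?\<B> U" if B: "B \<in> ?S" for B
  proof -
    have B': "subspace B" using B by (simp add: mem_subspaces_of_dim)
    \<comment> \<open>Otherwise \<open>C \<inter> B\<close>, of dimension at least t, would be all
      of \<open>T\<close>, and \<open>T\<close> would lie in \<open>C\<close>.\<close>
    have "\<not> C \<inter> B \<subseteq> T"
    proof
      assume "C \<inter> B \<subseteq> T"
      then have "C \<inter> B = T"
        using B B' T' C' by (intro subspace_dim_equal) (auto simp: subspace_inter)
      then show False using assms(3) by blast
    qed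
    then obtain v where v: "v \<in> C" "v \<in> B" "v \<notin> T" by blast
    have "span (insert v T) \<subseteq> B" using B v by (intro span_minimal[OF _ B']) auto
    moreover have "span (insert v T) \<subseteq> ?W"
      using v TW CW by (intro span_minimal[OF _ subspace_span]) auto
    moreover have "dim (span (insert v T)) = Suc t"
      using dim_span_insert[OF T'(1) v(3)] T'(2) by simp
    moreover have "T \<subseteq> span (insert v T)" using span_superset[of "insert v T"] by simp
    ultimately have "span (insert v T) \<in> ?\<U>" "B \<in> ?\<B> (span (insert v T))"
      using B by (simp_all del: dim_span)
    then show ?thesis by (rule bexI[rotated])
  qed
  then have "?S \<subseteq> (\<Union>U\<in>?\<U>. ?\<B> U)" by (intro subsetI) (simp only: UN_iff)
  then have "card ?S \<le> card (\<Union>U\<in>?\<U>. ?\<B> U)" by (intro card_mono) auto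
  also have "\<dots> \<le> (\<Sum>U\<in>?\<U>. card (?\<B> U))" by (rule card_UN_le) auto
  finally have "real (card ?S) \<le> (\<Sum>U\<in>?\<U>. real (card (?\<B> U)))" by (simp flip: of_nat_sum)
  also have "\<dots> = (\<Sum>U\<in>?\<U>. gaussian (dim UNIV - Suc t) (k - Suc t))"
    using assms by (intro sum.cong card_superspaces) (auto simp: mem_subspaces_of_dim)
  also have "\<dots> = real (card ?\<U>) * gaussian (dim UNIV - Suc t) (k - Suc t)" by simp
  also have "\<dots> \<le> gaussian k 1 * gaussian (dim UNIV - Suc t) (k - Suc t)"
  proof (rule mult_right_mono)
    \<comment> \<open>\<open>?W\<close> exceeds \<open>T\<close> by at most k dimensions, so it has
      at most as many (t + 1)-spaces over \<open>T\<close> as a k-space has points.\<close>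
    have "k \<le> dim ?W" using dim_subset[OF CW] C'(2) by simp
    then have "real (card ?\<U>) = gauss_binomial ?q (dim ?W - t) 1"
      using card_subspaces_between[of T ?W "Suc t"] T' TW assms(4) by simp
    also have "\<dots> \<le> gauss_binomial ?q k 1"
      unfolding gauss_binomial_1
    proof (intro divide_right_mono diff_right_mono power_increasing)
      show "dim ?W - t \<le> k" using dim_Un_le[of T C] T' C' by simp
    qed (use CARD_field_gt_1 in auto)
    finally show "real (card ?\<U>) \<le> gaussian k 1" by (simp add: gaussian_def)
    show "0 \<le> gaussian (dim UNIV - Suc t) (k - Suc t)"
      using gauss_binomial_ge_1[of ?q "k - Suc t" "dim UNIV - Suc t"] CARD_field_gt_1
        diff_le_mono[OF assms(5)]
      by (simp add: gaussian_def)
  qed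
  finally show ?thesis .
qed

section \<open>The total intersection number under insertion, and its lower bound from stars\<close>

lemma total_inter_insert:
  assumes "C \<notin> F"
  shows "total_inter scale (insert C F)
    = total_inter scale F + 2 * (\<Sum>B\<in>F. dim (C \<inter> B)) + dim C"
  using assms by (simp add: total_inter_def sum.distrib Int_commute[of _ C])

lemma total_inter_le_max:
  assumes "G \<subseteq> subspaces_of_dim scale k" "card G = card F"
  shows "total_inter scale G \<le> max_total_inter scale k F"
  unfolding max_total_inter_def using assms by (intro Max_ge) auto

text \<open>Two members containing \<open>T\<close> meet in dimension at least t; all other pairs
  are dropped.\<close>

lemma total_inter_ge_star:
  assumes "T \<in> subspaces_of_dim scale t"
  shows "t * (card {A \<in> G. T \<subseteq> A})\<^sup>2 \<le> total_inter scale G"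
proof -
  let ?P = "{A \<in> G. T \<subseteq> A}"
  have "t * (card ?P)\<^sup>2 = (\<Sum>A\<in>?P. \<Sum>B\<in>?P. t)" by (simp add: power2_eq_square)
  also have "\<dots> \<le> (\<Sum>A\<in>?P. \<Sum>B\<in>?P. dim (A \<inter> B))"
  proof (intro sum_mono)
    fix A B assume "A \<in> ?P" "B \<in> ?P"
    then have "dim T \<le> dim (A \<inter> B)" by (intro dim_subset) auto
    then show "t \<le> dim (A \<inter> B)" using assms by (simp add: mem_subspaces_of_dim)
  qed
  also have "\<dots> \<le> (\<Sum>A\<in>?P. \<Sum>B\<in>G. dim (A \<inter> B))"
    by (intro sum_mono sum_mono2) auto
  also have "\<dots> \<le> total_inter scale G"
    unfolding total_inter_def by (intro sum_mono2) auto
  finally show ?thesis .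
qed

end

subsection \<open>Large families\<close>

text \<open>The factor \<open>256 * (k + 1) ^ 4\<close> is \<open>(4 * k + 4) ^ 4\<close>, the product of the lower bounds on \<open>\<delta>\<close> and on \<open>n\<close>.\<close>

locale large_family = finite_field_space scale Basis
  for scale :: "'f :: {finite, field} \<Rightarrow> 'v :: ab_group_add \<Rightarrow> 'v" and Basis +
  fixes k t :: nat and F :: "'v set set"
  assumes t_pos: "1 \<le> t" and t_less: "t < k" and k_le: "k \<le> dim UNIV"
    and F_sub: "F \<subseteq> subspaces_of_dim scale k"
    and card_large: "256 * (real k + 1) ^ 4 *
      ((gaussian k t)\<^sup>2 * gaussian (dim UNIV - Suc t) (k - Suc t)) \<le> real (card F)"
begin

text \<open>The number of t-subspaces of a k-space.\<close>

definition N :: real where "N = gaussian k t"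

text \<open>The number of k-spaces through a fixed (t + 1)-space; \<open>N\<^sup>2 * M\<close>
  serves as the error term throughout.\<close>

definition M :: real where "M = gaussian (dim UNIV - Suc t) (k - Suc t)"

abbreviation m :: real where "m \<equiv> real (card F)"

text \<open>The exceptional fraction is so small that, even weighted by k + 1, it costs only a tenth
  of \<open>F\<close>, which an exchange can afford.\<close>

definition popular :: "'v set \<Rightarrow> bool" where
  "popular T \<longleftrightarrow> T \<in> subspaces_of_dim scale t \<and>
     real (card {B \<in> F. T \<subseteq> B}) \<ge> m * (1 - 1 / (10 * (real k + 1)))"

lemma large: "256 * (real k + 1) ^ 4 * (N\<^sup>2 * M) \<le> m"
  unfolding N_def M_def by (rule card_large)

lemma N_ge_1: "N \<ge> 1"
  unfolding N_def gaussian_def using CARD_field_gt_1 t_less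
  by (intro gauss_binomial_ge_1) auto

lemma M_ge_1: "M \<ge> 1"
  unfolding M_def gaussian_def using CARD_field_gt_1 t_less k_le
  by (intro gauss_binomial_ge_1) auto

lemma N_M_le: "N * M \<le> N\<^sup>2 * M"
  using N_ge_1 M_ge_1 self_le_power[of N 2] by (intro mult_right_mono) auto

lemma error_pos: "N\<^sup>2 * M > 0"
  using N_ge_1 M_ge_1 by simp

lemma k_ge_2: "k \<ge> 2"
  using t_pos t_less by linarith

lemma error_le: "(real k + 1) * (N\<^sup>2 * M) \<le> m / 6912"
proof -
  \<comment> \<open>As k is at least 2, three of the four factors contribute at least 27, and 256 *
    27 = 6912.\<close>
  have "27 * (real k + 1) \<le> (real k + 1) ^ 3 * (real k + 1)"
    using k_ge_2 power_mono[of 3 "real k + 1" 3] by (intro mult_right_mono) auto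
  also have "\<dots> = (real k + 1) ^ 4" by (simp add: eval_nat_numeral)
  finally have "256 * (27 * (real k + 1)) * (N\<^sup>2 * M) \<le> 256 * (real k + 1) ^ 4 * (N\<^sup>2 * M)"
    using error_pos by (intro mult_right_mono) auto
  then have "256 * (27 * (real k + 1)) * (N\<^sup>2 * M) \<le> m" using large by (rule order_trans)
  then show ?thesis by (simp add: algebra_simps)
qed

lemma m_pos: "m > 0"
proof -
  have "(real k + 1) * (N\<^sup>2 * M) > 0" using error_pos by (intro mult_pos_pos[OF _ error_pos]) simp
  then show ?thesis using error_le by linarith
qed

text \<open>\<open>A\<close> has at most \<open>N\<^sup>2\<close> subspaces of dimension t + 1, each
  contained in at most \<open>M\<close> members.\<close>

lemma card_dim_Int_gt_le_error:
  assumes "A \<in> subspaces_of_dim scale k"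
  shows "real (card {B \<in> F. t < dim (A \<inter> B)}) \<le> N\<^sup>2 * M"
proof -
  have "real (card {B \<in> F. t < dim (A \<inter> B)})
      \<le> real (card {B \<in> subspaces_of_dim scale k. t < dim (A \<inter> B)})"
    using F_sub by (simp, intro card_mono) auto
  also have "\<dots> \<le> gaussian k (Suc t) * M"
    unfolding M_def by (rule card_dim_Int_gt_le[OF assms t_less k_le])
  also have "\<dots> \<le> N\<^sup>2 * M"
    unfolding N_def gaussian_def using CARD_field_gt_1 t_pos t_less M_ge_1
    by (intro mult_right_mono gauss_binomial_Suc_le_square) auto
  finally show ?thesis .
qed

lemma card_superspaces_dim_Int_ge_le_error:
  assumes "T \<in> subspaces_of_dim scale t" "C \<in> subspaces_of_dim scale k" "\<not> T \<subseteq> C"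
  shows "real (card {B \<in> F. T \<subseteq> B \<and> t \<le> dim (C \<inter> B)}) \<le> N * M"
proof -
  have "real (card {B \<in> F. T \<subseteq> B \<and> t \<le> dim (C \<inter> B)})
      \<le> real (card {B \<in> subspaces_of_dim scale k. T \<subseteq> B \<and> t \<le> dim (C \<inter> B)})"
    using F_sub by (simp, intro card_mono) auto
  also have "\<dots> \<le> gaussian k 1 * M"
    unfolding M_def by (rule card_superspaces_dim_Int_ge_le[OF assms t_less k_le])
  also have "\<dots> \<le> N * M"
    unfolding N_def gaussian_def using CARD_field_gt_1 t_pos t_less M_ge_1
    by (intro mult_right_mono gauss_binomial_1_le) auto
  finally show ?thesis .
qed

text \<open>Compared with t per member, a \<open>B\<close> meeting \<open>A\<close> in more than t
  dimensions adds at most k, and one meeting \<open>A\<close> in fewer loses at least 1, which pays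
  for its being counted on the left.\<close>

lemma sum_dim_Int_le:
  assumes A: "A \<in> subspaces_of_dim scale k"
  shows "(\<Sum>B\<in>F. real (dim (A \<inter> B))) + real (card {B \<in> F. dim (A \<inter> B) < t})
    \<le> real t * m + real k * (N\<^sup>2 * M)"
proof -
  have "(\<Sum>B\<in>F. real (dim (A \<inter> B))) + (\<Sum>B\<in>F. of_bool (dim (A \<inter> B) < t))
      = (\<Sum>B\<in>F. real (dim (A \<inter> B)) + of_bool (dim (A \<inter> B) < t))"
    by (rule sum.distrib[symmetric])
  also have "\<dots> \<le> (\<Sum>B\<in>F. real t + real k * of_bool (t < dim (A \<inter> B)))"
  proof (rule sum_mono)
    fix B
    have "dim (A \<inter> B) \<le> k" using A dim_subset[of "A \<inter> B" A] by (simp add: mem_subspaces_of_dim)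
    then show "real (dim (A \<inter> B)) + of_bool (dim (A \<inter> B) < t)
        \<le> real t + real k * of_bool (t < dim (A \<inter> B))" by auto
  qed
  also have "\<dots> = real t * m + real k * real (card {B \<in> F. t < dim (A \<inter> B)})"
    by (simp add: sum.distrib Collect_conj_eq flip: sum_distrib_left)
  also have "\<dots> \<le> real t * m + real k * (N\<^sup>2 * M)"
    using card_dim_Int_gt_le_error[OF A] by (intro add_left_mono mult_left_mono) auto
  finally show ?thesis by (simp add: Collect_conj_eq)
qed

section \<open>Finding a popular t-space\<close>

lemma exists_popular:
  assumes inter: "real (total_inter scale F) \<ge> real t * m\<^sup>2 - m\<^sup>2 / (24 * (real k + 1))"
  shows "\<exists>T. popular T"
proof -
  let ?e = "N\<^sup>2 * M" and ?K = "real k + 1"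
  let ?bad = "\<lambda>A. real (card {B \<in> F. dim (A \<inter> B) < t})"
  \<comment> \<open>\<open>g\<close> will bound the average of \<open>?bad A\<close> over
    \<open>F\<close>: 1 / 24 from the hypothesis and 1 / 2304 from the error term add up to less
    than 1 / 23.\<close>
  define g where "g = m / (23 * ?K)"
  have K: "?K \<ge> 3" using k_ge_2 by simp
  \<comment> \<open>Since \<open>?K\<close> is at least 3, two of the four factors in
    \<open>large\<close> contribute at least 9, and 256 * 9 = 2304.\<close>
  have "2304 * (real k * ?K * ?e) \<le> (256 * 3 ^ 2) * (?K * ?K * ?e)"
  proof -
    have "0 \<le> ?K * ?e" using K error_pos by (intro mult_nonneg_nonneg[OF _ less_imp_le]) auto
    then show ?thesis using mult_right_mono[of "real k" ?K "?K * ?e"] by (simp add: mult_ac)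
  qed
  also have "\<dots> \<le> (256 * ?K ^ 2) * (?K * ?K * ?e)"
    using K error_pos by (intro mult_right_mono mult_left_mono power_mono) auto
  also have "\<dots> = 256 * ?K ^ 4 * ?e" by (simp add: eval_nat_numeral)
  also have "\<dots> \<le> m" by (rule large)
  finally have "real k * ?K * ?e \<le> m / 2304" by simp
  then have "real k * ?K * ?e / ?K \<le> m / 2304 / ?K" by (rule divide_right_mono) simp
  moreover have "real k * ?K * ?e / ?K = real k * ?e" using K by simp
  ultimately have ke: "real k * ?e \<le> m / 2304 / ?K" by simp
  have "?K * ?e / ?K \<le> m / 6912 / ?K" using error_le by (rule divide_right_mono) simp
  moreover have "?K * ?e / ?K = ?e" using K by simp
  ultimately have e: "?e \<le> m / 6912 / ?K" by simp
  have g69: "g \<le> m / 69" unfolding g_def using K m_pos by (intro divide_left_mono) auto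
  have eg: "?e \<le> g / 300" using e m_pos K unfolding g_def by (simp add: field_simps)
  have g_pos: "g > 0" unfolding g_def using m_pos K by simp
  have bad_sum: "(\<Sum>A\<in>F. ?bad A) \<le> g * m"
  proof -
    \<comment> \<open>The upper bound on the total, bad pairs included, nearly matches the
      hypothesis and so leaves little room for bad pairs.\<close>
    have "real (total_inter scale F) + (\<Sum>A\<in>F. ?bad A)
        = (\<Sum>A\<in>F. (\<Sum>B\<in>F. real (dim (A \<inter> B))) + ?bad A)"
      by (simp add: total_inter_def sum.distrib)
    also have "\<dots> \<le> (\<Sum>A\<in>F. real t * m + real k * ?e)"
      using F_sub by (intro sum_mono sum_dim_Int_le) auto
    also have "\<dots> = real t * m\<^sup>2 + m * (real k * ?e)"
      by (simp add: power2_eq_square algebra_simps)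
    also have "\<dots> \<le> real t * m\<^sup>2 + m * (m / 2304 / ?K)"
      using ke m_pos by (intro add_left_mono mult_left_mono) auto
    finally have "(\<Sum>A\<in>F. ?bad A) \<le> m\<^sup>2 / (24 * ?K) + m * (m / 2304 / ?K)"
      using inter by linarith
    also have "m\<^sup>2 / (24 * ?K) = m\<^sup>2 / 24 / ?K" by simp
    also have "m * (m / 2304 / ?K) = m\<^sup>2 / 2304 / ?K" by (simp add: power2_eq_square)
    also have "m\<^sup>2 / 24 / ?K + m\<^sup>2 / 2304 / ?K = m\<^sup>2 * (97 / 2304) / ?K"
      unfolding add_divide_distrib[symmetric] by simp
    also have "\<dots> \<le> m\<^sup>2 * (1 / 23) / ?K" using K by (intro divide_right_mono mult_left_mono) auto
    also have "\<dots> = g * m" by (simp add: g_def power2_eq_square)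
    finally show ?thesis .
  qed
  have "finite F" "F \<noteq> {}" using m_pos by auto
  then obtain A where A: "A \<in> F" "m * ?bad A \<le> g * m"
    using bad_sum by (rule sum_le_imp_exists_card_times_le)
  have bad_A: "?bad A \<le> g" using A(2) m_pos by (simp add: mult.commute)
  have A': "subspace A" "dim A = k" "A \<in> subspaces_of_dim scale k"
    using A(1) F_sub by (auto simp: mem_subspaces_of_dim)
  define X where "X = {B \<in> F. dim (A \<inter> B) = t}"
  have "F \<subseteq> X \<union> {B \<in> F. dim (A \<inter> B) < t} \<union> {B \<in> F. t < dim (A \<inter> B)}"
    unfolding X_def by auto
  then have "card F \<le> card (X \<union> {B \<in> F. dim (A \<inter> B) < t} \<union> {B \<in> F. t < dim (A \<inter> B)})"
    by (intro card_mono) auto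
  also have "\<dots> \<le> card X + card {B \<in> F. dim (A \<inter> B) < t} + card {B \<in> F. t < dim (A \<inter> B)}"
    by (meson add_le_mono1 card_Un_le le_trans)
  finally have X: "real (card X) \<ge> m - g - ?e"
    using bad_A card_dim_Int_gt_le_error[OF A'(3)] by linarith
  have X_large: "real (card X) \<ge> 49 / 50 * m" using X eg g69 by linarith
  \<comment> \<open>A second averaging, over \<open>X\<close> only, so that
    \<open>A \<inter> C\<close> has dimension exactly t; the smaller index set costs the factor 50 /
    49.\<close>
  have "(\<Sum>C\<in>X. ?bad C) \<le> (\<Sum>A\<in>F. ?bad A)"
    unfolding X_def by (intro sum_mono2) auto
  then have "(\<Sum>C\<in>X. ?bad C) \<le> g * m" using bad_sum by linarith
  moreover have "finite X" "X \<noteq> {}" using X_large m_pos by auto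
  ultimately obtain C where C: "C \<in> X" "real (card X) * ?bad C \<le> g * m"
    using sum_le_imp_exists_card_times_le[of X ?bad "g * m"] by blast
  have "49 / 50 * m * ?bad C \<le> g * m"
    using mult_right_mono[OF X_large, of "?bad C"] C(2) by simp
  then have bad_C: "?bad C \<le> 50 / 49 * g" using m_pos by simp
  define T where "T = A \<inter> C"
  have C': "subspace C" "C \<in> subspaces_of_dim scale k" "dim T = t"
    using C(1) F_sub unfolding X_def T_def by (auto simp: mem_subspaces_of_dim)
  have T: "subspace T" "T \<in> subspaces_of_dim scale t"
    unfolding T_def using A' C' by (auto simp: mem_subspaces_of_dim subspace_inter T_def)
  \<comment> \<open>A member of \<open>X\<close> not containing \<open>T\<close> will be charged to
    its trace on \<open>A\<close>, a t-subspace of \<open>A\<close> different from \<open>T\<close>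
    and hence not inside \<open>C\<close>.\<close>
  let ?\<T> = "{T' \<in> subspaces_of_dim scale t. T' \<subseteq> A \<and> \<not> T' \<subseteq> C}"
  let ?\<B> = "\<lambda>T'. {B \<in> F. T' \<subseteq> B \<and> t \<le> dim (C \<inter> B)}"
  have cover: "\<exists>T'\<in>?\<T>. B \<in> ?\<B> T'"
    if B: "B \<in> X" "t \<le> dim (C \<inter> B)" "\<not> T \<subseteq> B" for B
  proof -
    have sub: "subspace (A \<inter> B)" and d: "dim (A \<inter> B) = t" and "B \<in> F"
      using B(1) A' F_sub by (auto simp: X_def mem_subspaces_of_dim intro!: subspace_inter)
    have "\<not> A \<inter> B \<subseteq> C"
    proof
      assume "A \<inter> B \<subseteq> C"
      then have "A \<inter> B = T"
        using sub T(1) d C'(3) by (intro subspace_dim_equal) (auto simp: T_def)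
      then show False using B(3) by blast
    qed
    then show ?thesis
      using sub d B \<open>B \<in> F\<close> by (intro bexI[of _ "A \<inter> B"]) (auto simp: mem_subspaces_of_dim)
  qed
  have "X \<subseteq> {B \<in> F. dim (C \<inter> B) < t} \<union> {B \<in> F. T \<subseteq> B} \<union> (\<Union>T'\<in>?\<T>. ?\<B> T')"
  proof
    fix B assume B: "B \<in> X"
    then have "B \<in> F" by (simp add: X_def)
    show "B \<in> {B \<in> F. dim (C \<inter> B) < t} \<union> {B \<in> F. T \<subseteq> B} \<union> (\<Union>T'\<in>?\<T>. ?\<B> T')"
    proof (cases "dim (C \<inter> B) < t \<or> T \<subseteq> B")
      case True
      then show ?thesis using \<open>B \<in> F\<close> by auto
    next
      case False
      then have "B \<in> (\<Union>T'\<in>?\<T>. ?\<B> T')"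
        unfolding UN_iff using B by (intro cover) (simp_all add: not_less)
      then show ?thesis by (rule UnI2)
    qed
  qed
  then have "card X \<le> card ({B \<in> F. dim (C \<inter> B) < t} \<union> {B \<in> F. T \<subseteq> B} \<union> (\<Union>T'\<in>?\<T>. ?\<B> T'))"
    by (intro card_mono) auto
  also have "\<dots> \<le> card {B \<in> F. dim (C \<inter> B) < t} + card {B \<in> F. T \<subseteq> B} + card (\<Union>T'\<in>?\<T>. ?\<B> T')"
    by (meson add_le_mono1 card_Un_le le_trans)
  finally have X_le: "real (card X)
      \<le> ?bad C + real (card {B \<in> F. T \<subseteq> B}) + real (card (\<Union>T'\<in>?\<T>. ?\<B> T'))" by linarith
  have "card (\<Union>T'\<in>?\<T>. ?\<B> T') \<le> (\<Sum>T'\<in>?\<T>. card (?\<B> T'))" by (rule card_UN_le) auto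
  then have "real (card (\<Union>T'\<in>?\<T>. ?\<B> T')) \<le> (\<Sum>T'\<in>?\<T>. real (card (?\<B> T')))"
    by (simp flip: of_nat_sum)
  also have "\<dots> \<le> (\<Sum>T'\<in>?\<T>. N * M)"
    using C'(2) by (intro sum_mono card_superspaces_dim_Int_ge_le_error) auto
  also have "\<dots> = real (card ?\<T>) * (N * M)" by simp
  also have "\<dots> \<le> N * (N * M)"
  proof (rule mult_right_mono)
    have "real (card ?\<T>) \<le> real (card {U \<in> subspaces_of_dim scale t. U \<subseteq> A})"
      by (simp, intro card_mono) auto
    also have "\<dots> = N" using card_subspaces_of[OF A'(1), of t] A'(2) t_less by (simp add: N_def)
    finally show "real (card ?\<T>) \<le> N" .
  qed (use N_ge_1 M_ge_1 in simp)
  finally have "real (card (\<Union>T'\<in>?\<T>. ?\<B> T')) \<le> ?e" by (simp add: power2_eq_square)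
  \<comment> \<open>The losses are \<open>g + ?e\<close> outside \<open>X\<close>,
    \<open>50 / 49 * g\<close> for \<open>C\<close>, and \<open>?e\<close> for the cover; as
    \<open>?e \<le> g / 300\<close>, they stay below \<open>23 / 10 * g\<close>.\<close>
  then have "real (card {B \<in> F. T \<subseteq> B}) \<ge> m - 23 / 10 * g"
    using X_le X bad_C eg g_pos by linarith
  also have "m - 23 / 10 * g = m * (1 - 1 / (10 * ?K))"
    unfolding g_def using K by (simp add: field_simps)
  finally show ?thesis using T(2) unfolding popular_def by blast
qed

text \<open>Most members contain \<open>T\<close>. These meet \<open>D\<close> in dimension at least
  t, while few of them meet \<open>C\<close> in dimension t or more; the gain of 1 on the others
  outweighs the possible loss on the rest.\<close>

lemma swap_increases_total_inter:
  assumes T: "popular T"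
    and C: "C \<in> F" "\<not> T \<subseteq> C"
    and D: "D \<in> subspaces_of_dim scale k" "T \<subseteq> D" "D \<notin> F"
  shows "total_inter scale F < total_inter scale (insert D (F - {C}))"
proof -
  let ?e = "N\<^sup>2 * M" and ?K = "real k + 1"
  let ?P = "{B \<in> F. T \<subseteq> B}"
  define x where "x = real (card ?P)"
  have T': "T \<in> subspaces_of_dim scale t" and x: "x \<ge> m * (1 - 1 / (10 * ?K))"
    using T by (auto simp: popular_def x_def)
  have C': "C \<in> subspaces_of_dim scale k" using C F_sub by auto
  have dims: "dim C = k" "dim D = k" using C' D by (auto simp: mem_subspaces_of_dim)
  have P: "?P \<subseteq> F - {C}" using C by auto
  have "real t * x = (\<Sum>B\<in>?P. real t)" by (simp add: x_def)
  also have "\<dots> \<le> (\<Sum>B\<in>?P. real (dim (D \<inter> B)))"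
  proof (rule sum_mono)
    fix B assume "B \<in> ?P"
    then have "dim T \<le> dim (D \<inter> B)" using D by (intro dim_subset) auto
    then show "real t \<le> real (dim (D \<inter> B))" using T' by (simp add: mem_subspaces_of_dim)
  qed
  also have "\<dots> \<le> (\<Sum>B\<in>F - {C}. real (dim (D \<inter> B)))"
    using P by (intro sum_mono2) auto
  finally have sum_D: "real t * x \<le> (\<Sum>B\<in>F - {C}. real (dim (D \<inter> B)))" .
  have dim_C: "dim (C \<inter> B) \<le> k" for B using dim_subset[of "C \<inter> B" C] dims by simp
  have "(\<Sum>B\<in>F - {C}. real (dim (C \<inter> B))) \<le> (\<Sum>B\<in>F. real (dim (C \<inter> B)))"
    by (intro sum_mono2) auto
  \<comment> \<open>A \<open>B\<close> containing \<open>T\<close> counts at most t - 1 unless it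
    meets \<open>C\<close> in dimension at least t, when an extra k suffices; any other
    \<open>B\<close> counts at most k.\<close>
  also have "\<dots> \<le> (\<Sum>B\<in>F. (real t - 1) * of_bool (T \<subseteq> B)
      + real k * of_bool (T \<subseteq> B \<and> t \<le> dim (C \<inter> B)) + real k * (1 - of_bool (T \<subseteq> B)))"
  proof (rule sum_mono)
    fix B
    show "real (dim (C \<inter> B)) \<le> (real t - 1) * of_bool (T \<subseteq> B)
      + real k * of_bool (T \<subseteq> B \<and> t \<le> dim (C \<inter> B)) + real k * (1 - of_bool (T \<subseteq> B))"
      using dim_C[of B] t_pos by (cases "T \<subseteq> B"; cases "t \<le> dim (C \<inter> B)") auto
  qed
  also have "\<dots> = (real t - 1) * x + real k * real (card {B \<in> F. T \<subseteq> B \<and> t \<le> dim (C \<inter> B)})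
      + real k * (m - x)"
    by (simp add: sum.distrib sum_subtractf x_def Collect_conj_eq flip: sum_distrib_left)
  also have "\<dots> \<le> (real t - 1) * x + real k * ?e + real k * (m - x)"
    using card_superspaces_dim_Int_ge_le_error[OF T' C' C(2)] N_M_le
    by (intro add_right_mono add_left_mono mult_left_mono) auto
  finally have sum_C: "(\<Sum>B\<in>F - {C}. real (dim (C \<inter> B)))
      \<le> (real t - 1) * x + real k * ?e + real k * (m - x)" .
  \<comment> \<open>The goal amounts to \<open>real k * m + real k * ?e < ?K * x\<close>, and
    popularity bounds the right side below by \<open>real k * m + 9 / 10 * m\<close>.\<close>
  have "?K * x \<ge> ?K * (m * (1 - 1 / (10 * ?K)))" using x by (intro mult_left_mono) auto
  also have "?K * (m * (1 - 1 / (10 * ?K))) = ?K * m - m / 10" by (simp add: field_simps)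
  finally have "?K * x \<ge> ?K * m - m / 10" .
  moreover have "real k * ?e \<le> m / 6912" using error_le error_pos by (simp add: algebra_simps)
  ultimately have "(real t - 1) * x + real k * ?e + real k * (m - x) < real t * x"
    using m_pos by (simp add: algebra_simps)
  then have "(\<Sum>B\<in>F - {C}. real (dim (C \<inter> B))) < (\<Sum>B\<in>F - {C}. real (dim (D \<inter> B)))"
    using sum_C sum_D by linarith
  then have "(\<Sum>B\<in>F - {C}. dim (C \<inter> B)) < (\<Sum>B\<in>F - {C}. dim (D \<inter> B))"
    by (simp flip: of_nat_sum)
  \<comment> \<open>\<open>C\<close> and \<open>D\<close> have equal dimension, so the diagonal
    terms agree and only the cross sums matter.\<close>
  then show ?thesis
    using total_inter_insert[of C "F - {C}"] total_inter_insert[of D "F - {C}"] C D dims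
    by (simp add: insert_absorb)
qed

end

section \<open>From the bounds on n and \<delta> to a popular t-space, and the comparison of
  sizes\<close>

theorem theorem1p5:
  fixes scale :: "'f :: {finite, field} \<Rightarrow> 'v :: ab_group_add \<Rightarrow> 'v"
    and q n k t :: nat and \<delta> :: real and F :: "'v set set"
  assumes "CARD('f) = q"
    and "vector_space scale"
    and "vector_space.dim scale (UNIV :: 'v set) = n"
    and "1 \<le> t" and "t < k"
    and "real n \<ge> (4 * real k + 4) ^ 2 * gauss_binomial (real q) k t ^ 2"
    and "F \<subseteq> subspaces_of_dim scale k"
    and "real (card F) = \<delta> * gauss_binomial (real q) (n - t) (k - t)"
    and "\<delta> \<in> {(4 * real k + 4) ^ 2 * real n / real q ^ (n - k) ..
              1 + 1 / (96 * real t * ln (real q) * (real k + 1))}"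
    and "total_inter scale F = max_total_inter scale k F"
  shows "(\<delta> \<le> 1 \<longrightarrow> (\<exists>S. full_star scale k t S \<and> F \<subseteq> S)) \<and>
         (\<delta> > 1 \<longrightarrow> (\<exists>S. full_star scale k t S \<and> S \<subseteq> F))"
proof -
  interpret vector_space scale by (rule assms(2))
  let ?K = "real k + 1" and ?m = "real (card F)"
  let ?N = "gauss_binomial (real q) k t"
  let ?M = "gauss_binomial (real q) (n - Suc t) (k - Suc t)"
  define S where "S = gauss_binomial (real q) (n - t) (k - t)"
  have q: "real q > 1"
    using card_mono[of UNIV "{0, 1 :: 'f}"] assms(1) by simp
  have N: "?N \<ge> 1" using q assms(5) by (intro gauss_binomial_ge_1) auto
  have n_ge: "(4 * real k + 4)\<^sup>2 * 1 \<le> real n"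
    using assms(6) N by (elim order_trans[rotated], intro mult_left_mono) auto
  have "real k \<le> (4 * real k + 4)\<^sup>2" by (simp add: power2_eq_square algebra_simps)
  then have "k \<le> n" "0 < n" using n_ge assms(5) by simp_all
  obtain Basis :: "'v set" where Basis: "independent Basis" "UNIV \<subseteq> span Basis" "card Basis = n"
    using basis_exists[of UNIV] assms(3) by metis
  have "finite Basis" using Basis(3) \<open>0 < n\<close> card_ge_0_finite by blast
  interpret finite_field_space scale Basis
    using Basis \<open>finite Basis\<close> by unfold_locales auto
  have M: "?M \<ge> 1" using q \<open>k \<le> n\<close> assms(5) by (intro gauss_binomial_ge_1) auto
  have S_ge: "real q ^ (n - k) * ?M \<le> S"
    using gauss_binomial_Suc_Suc_ge[OF q, of "k - Suc t" "n - Suc t"] \<open>k \<le> n\<close> assms(5)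
    by (simp add: S_def Suc_diff_Suc)
  have S_pos: "S > 0"
    unfolding S_def using gauss_binomial_ge_1[OF q, of "k - t" "n - t"] diff_le_mono[OF \<open>k \<le> n\<close>] by force
  have m_eq: "?m = \<delta> * S" using assms(8) by (simp add: S_def)
  \<comment> \<open>One square, together with \<open>?N\<^sup>2\<close>, is absorbed by the bound on
    n; the other, together with that n, by the lower bound on \<delta> and
    \<open>S_ge\<close>.\<close>
  have "256 * ?K ^ 4 * (?N\<^sup>2 * ?M) = (4 * real k + 4)\<^sup>2 * ((4 * real k + 4)\<^sup>2 * ?N\<^sup>2) * ?M"
    by (simp add: eval_nat_numeral algebra_simps)
  also have "\<dots> \<le> (4 * real k + 4)\<^sup>2 * real n * ?M"
    using assms(6) M by (intro mult_right_mono mult_left_mono) auto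
  also have "\<dots> = (4 * real k + 4)\<^sup>2 * real n / real q ^ (n - k) * (real q ^ (n - k) * ?M)"
    using q by simp
  also have "\<dots> \<le> (4 * real k + 4)\<^sup>2 * real n / real q ^ (n - k) * S"
    using S_ge by (intro mult_left_mono) auto
  also have "\<dots> \<le> \<delta> * S" using assms(9) S_pos by (intro mult_right_mono) auto
  finally have large: "256 * ?K ^ 4 * (?N\<^sup>2 * ?M) \<le> ?m" using m_eq by simp
  interpret large_family scale Basis k t F
    using assms \<open>k \<le> n\<close> large by unfold_locales (simp_all add: gaussian_def Basis(3))
  let ?star = "\<lambda>T. {A \<in> subspaces_of_dim scale k. T \<subseteq> A}"
  have card_star: "real (card (?star T)) = S" if "T \<in> subspaces_of_dim scale t" for T
    using card_superspaces[OF that, of k] assms \<open>k \<le> n\<close> by (simp add: gaussian_def S_def)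
  have "real (total_inter scale F) \<ge> real t * ?m\<^sup>2 - ?m\<^sup>2 / (24 * ?K)"
  proof -
    obtain T where T: "subspace T" "dim T = t"
      using choose_subspace_of_subspace[of t UNIV] assms \<open>k \<le> n\<close> by auto
    then have T': "T \<in> subspaces_of_dim scale t" by (simp add: mem_subspaces_of_dim)
    obtain G where G: "G \<subseteq> subspaces_of_dim scale k" "card G = card F" "G \<subseteq> ?star T \<or> ?star T \<subseteq> G"
      using exists_comparable_subset_of_card[of "subspaces_of_dim scale k" "?star T" "card F"]
        card_mono[OF _ assms(7)] by auto
    let ?P = "{A \<in> G. T \<subseteq> A}"
    have "real t * ?m\<^sup>2 - ?m\<^sup>2 / (24 * ?K) \<le> real t * (real (card ?P))\<^sup>2"
    \<comment> \<open>Inside the star every pair counts and nothing is lost. Otherwise the star lies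
      in \<open>G\<close> and has \<open>?m / \<delta>\<close> members, with \<delta> only slightly
      above 1.\<close>
    proof (cases "G \<subseteq> ?star T")
      case True
      then have "?P = G" by auto
      then show ?thesis using G(2) by simp
    next
      case False
      then have "?star T \<subset> G" using G(3) by auto
      then have P: "?P = ?star T" using G(1) by auto
      have "card (?star T) < card F"
        using \<open>?star T \<subset> G\<close> G(2) psubset_card_mono[of G] by auto
      then have "S < \<delta> * S" using card_star[OF T'] m_eq by linarith
      then have \<delta>: "\<delta> > 1" using S_pos by simp
      \<comment> \<open>As q is at least 2, this gives \<open>ln q \<ge> 1 / 2\<close>, which turns
        the constant 48 below into 24.\<close>
      have "exp (1 / 2) \<le> real q" using exp_half_le2 q by simp
      then have ln: "ln (real q) \<ge> 1 / 2" using q ln_ge_iff[of "real q" "1 / 2"] by linarith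
      have "2 * real t * (\<delta> - 1) \<le> 2 * real t * (1 / (96 * real t * ln (real q) * ?K))"
        using assms(9) by (intro mult_left_mono) auto
      also have "\<dots> = 1 / (48 * ln (real q) * ?K)" using assms(4) ln by simp
      also have "\<dots> \<le> 1 / (24 * ?K)"
        using ln by (intro divide_left_mono mult_right_mono mult_pos_pos) auto
      finally have "?m\<^sup>2 * (2 * real t * (\<delta> - 1)) \<le> ?m\<^sup>2 * (1 / (24 * ?K))"
        by (intro mult_left_mono) auto
      then have "real t * ?m\<^sup>2 - ?m\<^sup>2 / (24 * ?K) \<le> real t * ?m\<^sup>2 * (1 - 2 * (\<delta> - 1))"
        by (simp add: algebra_simps)
      also have "\<dots> \<le> real t * ?m\<^sup>2 * (1 / \<delta>\<^sup>2)"
        using \<delta> by (intro mult_left_mono inverse_square_ge) auto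
      also have "\<dots> = real t * (real (card ?P))\<^sup>2"
        using m_eq \<delta> card_star[OF T'] P by (simp add: power_mult_distrib)
      finally show ?thesis .
    qed
    also have "\<dots> = real (t * (card ?P)\<^sup>2)" by simp
    also have "\<dots> \<le> real (total_inter scale G)"
      using total_inter_ge_star[OF T', of G] by (simp only: of_nat_le_iff)
    also have "\<dots> \<le> real (total_inter scale F)"
      using total_inter_le_max[OF G(1,2)] assms(10) by simp
    finally show ?thesis .
  qed
  then obtain T where T: "popular T" using exists_popular by blast
  then have T': "T \<in> subspaces_of_dim scale t" by (simp add: popular_def)
  have star: "full_star scale k t (?star T)" using T' by (auto simp: full_star_def)
  have no_swap: "F \<subseteq> ?star T \<or> ?star T \<subseteq> F"
  proof (rule ccontr)
    assume "\<not> ?thesis"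
    then obtain C D where CD: "C \<in> F" "\<not> T \<subseteq> C" "D \<in> subspaces_of_dim scale k" "T \<subseteq> D" "D \<notin> F"
      using assms(7) by blast
    have "card (insert D (F - {C})) = card F"
      using CD card_Suc_Diff1[of F C] by simp
    then have "total_inter scale (insert D (F - {C})) \<le> total_inter scale F"
      using total_inter_le_max[of "insert D (F - {C})" k F] CD(3) assms(7,10) by auto
    then show False using swap_increases_total_inter[OF T CD] by simp
  qed
  have "F \<subseteq> ?star T" if "\<delta> \<le> 1"
  proof -
    \<comment> \<open>Should the star be contained in \<open>F\<close>, this forces
      equality.\<close>
    have "?m \<le> real (card (?star T))"
      using that S_pos m_eq card_star[OF T'] by simp
    then show ?thesis using no_swap card_seteq[of F "?star T"] by auto
  qed
  moreover have "?star T \<subseteq> F" if "\<delta> > 1"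
  proof -
    have "real (card (?star T)) \<le> ?m"
      using that S_pos m_eq card_star[OF T'] by simp
    then show ?thesis using no_swap card_seteq[of "?star T" F] by auto
  qed
  ultimately show ?thesis using star by blast
qed

end
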